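(* Consider an arbitrary power series of the form $\sum_{\lambda\in\mathcal P}f(\lambda)q^{|\lambda|}\in\mathbb C[[q]]$, where $f:\mathcal P\to\mathbb C$. Then the function $F:\mathcal P\to\mathbb C$ given by $$F(\lambda)=\sum_{\delta|\lambda}f(\delta)$$ satisfies $$\left<F\right>_q=\sum_{\lambda\in\mathcal P}f(\lambda)q^{|\lambda|}.$$
   Context: $\mathcal P$ is the set of all integer partitions $\lambda=(\lambda_1,\dots,\lambda_r)$, $\lambda_1\ge\cdots\ge\lambda_r\ge1$, including the empty partition $\emptyset$. The size is $|\lambda|=\lambda_1+\cdots+\lambda_r$, with $|\emptyset|=0$. A partition $\delta$ divides $\lambda$, written $\delta|\lambda$, if all parts of $\delta$ are also parts of $\lambda$, including multiplicity (i.e. $\delta$ is a sub-multiset of $\lambda$); $\emptyset$ divides every partition. A sum over $\delta|\lambda$ runs over the distinct partitions $\delta$ dividing $\lambda$ (each counted once). For a function $f:\mathcal P\to\mathbb C$ the $q$-bracket is $$\left<f\right>_q:=\frac{\sum_{\lambda\in\mathcal P}f(\lambda)q^{|\lambda|}}{\sum_{\lambda\in\mathcal P}q^{|\lambda|}}\in\mathbb C[[q]].$$ *)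

theory Defs
  imports Complex_Main "HOL-Library.Multiset" "HOL-Computational_Algebra.Formal_Power_Series"
begin

text \<open>
  An integer partition is represented by the multiset of its parts; the empty partition
  is \<open>{#}\<close>, the size is \<^const>\<open>sum_mset\<close>, and \<open>\<delta>\<close> divides
  \<open>\<mu>\<close> iff \<open>\<delta> \<subseteq># \<mu>\<close>.  Functions on partitions are total
  functions on multisets whose values outside \<open>partitions\<close> are never used.
\<close>

definition partitions :: "nat multiset set" where
  "partitions = {\<mu>. \<forall>k \<in># \<mu>. k \<ge> 1}"

lemma finite_partitions_of_size: "finite {\<mu> \<in> partitions. sum_mset \<mu> = n}"
proof (rule finite_subset)
  show "{\<mu> \<in> partitions. sum_mset \<mu> = n}
          \<subseteq> mset ` {xs. set xs \<subseteq> {..n} \<and> length xs \<le> n}"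
  proof
    fix \<mu> assume "\<mu> \<in> {\<mu> \<in> partitions. sum_mset \<mu> = n}"
    then have pos: "\<forall>k \<in># \<mu>. k \<ge> 1" and n: "sum_mset \<mu> = n"
      by (auto simp: partitions_def)
    obtain xs where xs: "\<mu> = mset xs" by (metis ex_mset)
    have n': "sum_list xs = n" using n xs by (simp add: sum_mset_sum_list)
    have "set xs \<subseteq> {..n}"
      using n' member_le_sum_list by blast
    moreover have "length xs \<le> sum_list xs"
      using pos unfolding xs by (induction xs) auto
    ultimately show "\<mu> \<in> mset ` {xs. set xs \<subseteq> {..n} \<and> length xs \<le> n}"
      using n' xs by simp
  qed
  show "finite (mset ` {xs. set xs \<subseteq> {..n} \<and> length xs \<le> n})"
    by (intro finite_imageI finite_lists_length_le) simp
qed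

lemma finite_divisors: "finite {\<delta> \<in> partitions. \<delta> \<subseteq># \<mu>}"
proof (rule finite_subset)
  show "{\<delta> \<in> partitions. \<delta> \<subseteq># \<mu>}
          \<subseteq> (\<Union>m\<le>sum_mset \<mu>. {\<delta> \<in> partitions. sum_mset \<delta> = m})"
    by (auto simp: subset_mset.le_iff_add)
qed (auto intro: finite_partitions_of_size)

text \<open>
  The formal series \<open>\<Sum>\<mu>\<in>partitions. f \<mu> q^|\<mu>|\<close>, with like powers of
  \<open>q\<close> collected: the coefficient of \<open>q^n\<close> is a finite sum
  by \<open>finite_partitions_of_size\<close>.
\<close>

definition partition_series :: "(nat multiset \<Rightarrow> complex) \<Rightarrow> complex fps" where
  "partition_series f = Abs_fps (\<lambda>n. \<Sum>\<mu> | \<mu> \<in> partitions \<and> sum_mset \<mu> = n. f \<mu>)"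

definition q_bracket :: "(nat multiset \<Rightarrow> complex) \<Rightarrow> complex fps" where
  "q_bracket f = partition_series f / partition_series (\<lambda>_. 1)"

text \<open>The denominator is a unit, so the quotient is the genuine one in the ring of power series.\<close>

lemma partition_series_one_nth_0: "fps_nth (partition_series (\<lambda>_. 1)) 0 = 1"
proof -
  have "{\<mu> \<in> partitions. sum_mset \<mu> = 0} = {{#}}"
  proof (intro equalityI subsetI)
    fix \<mu> assume "\<mu> \<in> {\<mu> \<in> partitions. sum_mset \<mu> = 0}"
    then show "\<mu> \<in> {{#}}" by (cases \<mu>) (simp_all add: partitions_def)
  qed (simp add: partitions_def)
  then show ?thesis by (simp add: partition_series_def)
qed

end

theory Submission
  imports Defs
begin

text \<open>
  Choosing a partition \<open>\<delta>\<close> together with an arbitrary second partition \<open>\<nu>\<close> is the same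
  as choosing the union \<open>\<mu> = \<delta> + \<nu>\<close> of their parts together with its divisor \<open>\<delta>\<close>;
  the quotient \<open>\<nu> = \<mu> - \<delta>\<close> is then determined, and sizes add.  Multiplying two
  partition series therefore amounts to a Dirichlet convolution of their coefficient functions
  over divisors (\<open>partition_series_mult\<close>).  When the second function is constantly 1, the
  convolution is the divisor sum, so that the series of the divisor sum of \<open>f\<close> is the series
  of \<open>f\<close> times the generating function of all partitions.  That generating function is
  invertible, having constant term 1, and dividing by it gives the claim.
\<close>

lemma add_mem_partitions_iff:
  "\<delta> + \<nu> \<in> partitions \<longleftrightarrow> \<delta> \<in> partitions \<and> \<nu> \<in> partitions"
  by (auto simp: partitions_def)

text \<open>
  Both sides have as \<open>n\<close>-th coefficient the sum of \<open>f \<delta> * g \<nu>\<close> over the pairs of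
  partitions of total size \<open>n\<close>.  The Cauchy product groups the pairs by the size of
  \<open>\<delta>\<close>, the convolution groups them by the union \<open>\<delta> + \<nu>\<close>.
\<close>

lemma partition_series_mult:
  "partition_series f * partition_series g =
     partition_series (\<lambda>\<mu>. \<Sum>\<delta> | \<delta> \<in> partitions \<and> \<delta> \<subseteq># \<mu>. f \<delta> * g (\<mu> - \<delta>))"
proof (rule fps_ext)
  fix n
  define P where "P m = {\<mu> \<in> partitions. sum_mset \<mu> = m}" for m
  define D where "D \<mu> = {\<delta> \<in> partitions. \<delta> \<subseteq># \<mu>}" for \<mu>
  have fin: "finite (P m)" "finite (D \<mu>)" for m \<mu>
    unfolding P_def D_def by (rule finite_partitions_of_size, rule finite_divisors)
  have nth: "fps_nth (partition_series h) m = (\<Sum>\<mu>\<in>P m. h \<mu>)" for h m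
    by (simp add: partition_series_def P_def)
  have "fps_nth (partition_series f * partition_series g) n =
          (\<Sum>i\<in>{0..n}. \<Sum>(\<delta>, \<nu>)\<in>P i \<times> P (n - i). f \<delta> * g \<nu>)"
    by (simp add: fps_mult_nth nth sum_product sum.cartesian_product)
  also have "\<dots> = (\<Sum>(i, \<delta>, \<nu>)\<in>(SIGMA i:{0..n}. P i \<times> P (n - i)). f \<delta> * g \<nu>)"
    using fin by (subst sum.Sigma) auto
  also have "\<dots> = (\<Sum>(\<mu>, \<delta>)\<in>Sigma (P n) D. f \<delta> * g (\<mu> - \<delta>))"
    by (rule sum.reindex_bij_witness[where
          i = "\<lambda>(\<mu>, \<delta>). (sum_mset \<delta>, \<delta>, \<mu> - \<delta>)" and j = "\<lambda>(i, \<delta>, \<nu>). (\<delta> + \<nu>, \<delta>)"])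
       (auto simp: P_def D_def add_mem_partitions_iff subset_mset.le_iff_add)
  also have "\<dots> = (\<Sum>\<mu>\<in>P n. \<Sum>\<delta>\<in>D \<mu>. f \<delta> * g (\<mu> - \<delta>))"
    using fin by (subst sum.Sigma) auto
  finally show "fps_nth (partition_series f * partition_series g) n =
      fps_nth (partition_series
        (\<lambda>\<mu>. \<Sum>\<delta> | \<delta> \<in> partitions \<and> \<delta> \<subseteq># \<mu>. f \<delta> * g (\<mu> - \<delta>))) n"
    by (simp add: nth D_def)
qed

lemma partition_series_cong:
  "(\<And>\<mu>. \<mu> \<in> partitions \<Longrightarrow> f \<mu> = g \<mu>) \<Longrightarrow> partition_series f = partition_series g"
  unfolding partition_series_def by (intro arg_cong[where f = Abs_fps] ext sum.cong) auto

theorem theorem4p2: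
  fixes f F :: "nat multiset \<Rightarrow> complex"
  assumes "\<And>\<mu>. \<mu> \<in> partitions \<Longrightarrow> F \<mu> = (\<Sum>\<delta> | \<delta> \<in> partitions \<and> \<delta> \<subseteq># \<mu>. f \<delta>)"
  shows "q_bracket F = partition_series f"
proof -
  have "partition_series F = partition_series f * partition_series (\<lambda>_. 1)"
    using partition_series_cong[OF assms] by (simp add: partition_series_mult)
  moreover have "partition_series (\<lambda>_. 1) \<noteq> 0"
    using partition_series_one_nth_0 by fastforce
  ultimately show ?thesis
    by (simp add: q_bracket_def)
qed

end
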